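(* Let $n\ge 1$, let $\Bbbk$ be a field of characteristic $p>0$, and let $R$ be a $\Bbbk$-subalgebra of the polynomial ring $\Bbbk[X]=\Bbbk[x_1,\dots,x_n]$. Let $J(R)$ be the Jacobian ideal of $R$. If $J(R)=\Bbbk[X]$, then $$R[X^p]=\Bbbk[X],$$ where $R[X^p]=R[x_1^p,\dots,x_n^p]$.
   Context: Jacobian ideal: for a $\Bbbk$-subalgebra $R$ of $\Bbbk[X]=\Bbbk[x_1,\dots,x_n]$, $J(R)$ is the ideal of $\Bbbk[X]$ defined by $J(R)\,\Omega^n_{\Bbbk[X]/\Bbbk}=\Bbbk[X]\,\Omega^n_{R/\Bbbk}$, where the right-hand side denotes the $\Bbbk[X]$-submodule of $\Omega^n_{\Bbbk[X]/\Bbbk}$ generated by the image of the natural map $\Omega^n_{R/\Bbbk}\to\Omega^n_{\Bbbk[X]/\Bbbk}$. Equivalently, $J(R)$ is the ideal of $\Bbbk[X]$ generated by all Jacobians $j(F)=\det\left(\frac{\partial f_i}{\partial x_j}\right)_{1\le i,j\le n}$ with $F=(f_1,\dots,f_n)\in R^n$. $R[x_1^p,\dots,x_n^p]$ is the subalgebra of $\Bbbk[X]$ generated by $R$ and $x_1^p,\dots,x_n^p$. *)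

theory Defs
  imports "HOL-Analysis.Analysis" "HOL-Library.Poly_Mapping"
begin

text \<open>
  Polynomials over \<open>'k\<close> in variables indexed by the finite type \<open>'n\<close>: finitely supported maps
  from exponent vectors to coefficients, with the convolution product of
  \<^theory>\<open>HOL-Library.Poly_Mapping\<close>. The number of variables is \<open>CARD('n)\<close>.
\<close>

type_synonym ('n, 'k) mpoly = "('n \<Rightarrow>\<^sub>0 nat) \<Rightarrow>\<^sub>0 'k"

definition Const :: "'k \<Rightarrow> ('n, 'k::zero) mpoly" where
  "Const c = Poly_Mapping.single 0 c"

definition Var :: "'n \<Rightarrow> ('n, 'k::zero_neq_one) mpoly" where
  "Var i = Poly_Mapping.single (Poly_Mapping.single i 1) 1"

text \<open>
  The subtraction of exponents below is truncated, which is harmless: if the exponent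
  of the variable is zero, then so is the coefficient.
\<close>

definition partial_deriv :: "'n \<Rightarrow> ('n, 'k::comm_ring_1) mpoly \<Rightarrow> ('n, 'k) mpoly" where
  "partial_deriv i f =
    (\<Sum>m\<in>Poly_Mapping.keys f.
      Poly_Mapping.single (m - Poly_Mapping.single i 1)
        (of_nat (Poly_Mapping.lookup m i) * Poly_Mapping.lookup f m))"

definition jacobian_det :: "(('n::finite, 'k::comm_ring_1) mpoly) ^ 'n \<Rightarrow> ('n, 'k) mpoly" where
  "jacobian_det F = det (\<chi> i j. partial_deriv j (F $ i))"

definition is_subalgebra :: "('n, 'k::comm_ring_1) mpoly set \<Rightarrow> bool" where
  "is_subalgebra R \<longleftrightarrow>
    (\<forall>c. Const c \<in> R) \<and> (\<forall>f\<in>R. \<forall>g\<in>R. f + g \<in> R) \<and> (\<forall>f\<in>R. \<forall>g\<in>R. f * g \<in> R)"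

definition adjoin :: "('n, 'k::comm_ring_1) mpoly set \<Rightarrow> ('n, 'k) mpoly set \<Rightarrow> ('n, 'k) mpoly set" where
  "adjoin R S = is_subalgebra hull (R \<union> S)"

text \<open>
  The ideal generated by a subset of a commutative ring is its span in the ring regarded as a
  module over itself.
  The module of \<open>n\<close>-forms of the polynomial ring is free on
  \<open>dx\<^sub>1 \<and> \<dots> \<and> dx\<^sub>n\<close>, and \<open>df\<^sub>1 \<and> \<dots> \<and> df\<^sub>n\<close> is the Jacobian determinant of
  \<open>(f\<^sub>1, \<dots>, f\<^sub>n)\<close> times that generator. So the coefficients of the submodule generated by the
  image of the \<open>n\<close>-forms of \<open>R\<close> are the ideal generated by the Jacobian determinants of
  tuples from \<open>R\<close>.
\<close>

lemma module_self: "module ((*) :: 'a::comm_ring_1 \<Rightarrow> 'a \<Rightarrow> 'a)"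
  by unfold_locales (simp_all add: algebra_simps)

definition jacobian_ideal :: "('n::finite, 'k::comm_ring_1) mpoly set \<Rightarrow> ('n, 'k) mpoly set" where
  "jacobian_ideal R = module.span (*) {jacobian_det F | F. \<forall>i. F $ i \<in> R}"

lemma lookup_partial_deriv:
  "Poly_Mapping.lookup (partial_deriv i f) m =
    of_nat (Suc (Poly_Mapping.lookup m i)) *
      Poly_Mapping.lookup f (m + Poly_Mapping.single i 1)"
proof -
  let ?e = "Poly_Mapping.single i (1::nat)"
  let ?t = "\<lambda>m'. of_nat (Poly_Mapping.lookup m' i) * Poly_Mapping.lookup f m'"
  have eq: "m' = m + ?e" if "Poly_Mapping.lookup m' i \<noteq> 0" "m' - ?e = m" for m'
  proof (rule poly_mapping_eqI)
    fix j
    have "Poly_Mapping.lookup m' j - Poly_Mapping.lookup ?e j = Poly_Mapping.lookup m j"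
      using lookup_minus[of m' ?e j] that(2) by simp
    with that(1) show "Poly_Mapping.lookup m' j = Poly_Mapping.lookup (m + ?e) j"
      by (cases "i = j") (simp_all add: lookup_add lookup_single)
  qed
  have "Poly_Mapping.lookup (partial_deriv i f) m =
      (\<Sum>m'\<in>Poly_Mapping.keys f. ?t m' when m' - ?e = m)"
    by (simp only: partial_deriv_def lookup_sum lookup_single)
  also have "\<dots> = (\<Sum>m'\<in>Poly_Mapping.keys f. if m' = m + ?e then ?t m' else 0)"
  proof (rule sum.cong[OF refl])
    fix m'
    show "(?t m' when m' - ?e = m) = (if m' = m + ?e then ?t m' else 0)"
    proof (cases "Poly_Mapping.lookup m' i = 0")
      case False
      then have "m' - ?e = m \<longleftrightarrow> m' = m + ?e"
        using eq[of m'] by (metis add_diff_cancel_right')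
      then show ?thesis by (simp only: when_def)
    next
      case True
      then have "?t m' = 0" by (simp only: of_nat_0 mult_zero_left)
      then show ?thesis by (simp only: when_def if_cancel)
    qed
  qed
  also have "\<dots> = ?t (m + ?e)"
    by (simp add: sum.delta[OF finite_keys] not_in_keys_iff_lookup_eq_zero)
  finally show ?thesis
    by (simp add: lookup_add)
qed

lemma is_subalgebra_adjoin: "is_subalgebra (adjoin R S)"
  unfolding adjoin_def by (rule hull_in) (auto simp: is_subalgebra_def)

end

theory Submission
  imports Defs "HOL-Computational_Algebra.Primes"
begin

text \<open>
  Let \<open>A = R[X\<^sup>p]\<close> and let \<open>j\<close> be the Jacobian of \<open>F \<in> R\<^sup>n\<close>. Cramer's rule gives derivations that
  are dual to \<open>F\<close> up to a power of \<open>j\<close>; multiplying by powers of \<open>j\<^sup>p\<close>, which every derivation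
  kills, makes them commute, have vanishing \<open>p\<close>-th power and send \<open>f\<^sub>k\<close> to \<open>c \<delta>\<^sub>i\<^sub>k\<close> with \<open>c\<close> a power
  of \<open>j\<^sup>p\<close>. Taylor expansion in \<open>F\<close>, with coefficients killed by all these derivations, then gives
  \<open>j\<^sup>p\<^sup>N g \<in> A\<close> for every polynomial \<open>g\<close> and some \<open>N\<close>. If \<open>1 = \<Sum> r\<^sub>t j\<^sub>t\<close>, then raising this to a
  large power \<open>q\<close> of \<open>p\<close> gives \<open>g = \<Sum> r\<^sub>t\<^sup>q (j\<^sub>t\<^sup>q g)\<close>, where \<open>r\<^sub>t\<^sup>q \<in> A\<close> because it is a polynomial
  in the \<open>x\<^sub>i\<^sup>p\<close>.
\<close>

section \<open>Two-sided quasi-inverses of matrices\<close>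

text \<open>Entry \<open>(k, i)\<close> is the cofactor at \<open>(i, k)\<close>: a unit vector in
  row \<open>i\<close> replaces the deletion of a row and a column, which would change the index
  type.\<close>

definition adjugate :: "'a::comm_ring_1^'n^'n \<Rightarrow> 'a^'n^'n::finite" where
  "adjugate M = (\<chi> k i. det (\<chi> r. if r = i then axis k 1 else row r M))"

text \<open>Laplace expansion along row \<open>i\<close>, from linearity of the determinant in that
  row.\<close>

lemma det_replace_row:
  fixes M :: "'a::comm_ring_1^'n^'n::finite"
  shows "det (\<chi> r. if r = i then w else row r M) = (\<Sum>k\<in>UNIV. w $ k * adjugate M $ k $ i)"
proof -
  have "w = (\<Sum>k\<in>UNIV. w $ k *s axis k 1)"
    by (simp add: basis_expansion)
  then have "det (\<chi> r. if r = i then w else row r M) =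
      det (\<chi> r. if r = i then (\<Sum>k\<in>UNIV. w $ k *s axis k 1) else row r M)"
    by (rule arg_cong[where f = "\<lambda>w. det (\<chi> r. if r = i then w else row r M)"])
  also have "\<dots> = (\<Sum>k\<in>UNIV. det (\<chi> r. if r = i then w $ k *s axis k 1 else row r M))"
    by (rule det_linear_row_sum) simp
  also have "\<dots> = (\<Sum>k\<in>UNIV. w $ k * adjugate M $ k $ i)"
    by (simp add: adjugate_def det_row_mul)
  finally show ?thesis .
qed

text \<open>By Laplace expansion, entry \<open>(l, i)\<close> of the product is the determinant of
  \<open>M\<close> with row \<open>i\<close> overwritten by row \<open>l\<close>; for
  \<open>l \<noteq> i\<close> two rows coincide.\<close>

lemma matrix_mul_adjugate:
  fixes M :: "'a::comm_ring_1^'n^'n::finite"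
  shows "M ** adjugate M = mat (det M)"
proof -
  have "(M ** adjugate M) $ l $ i = mat (det M) $ l $ i" for l i
  proof -
    let ?N = "\<chi> r. if r = i then row l M else row r M"
    have "(M ** adjugate M) $ l $ i = det ?N"
      unfolding det_replace_row by (simp add: matrix_matrix_mult_def row_def)
    also have "\<dots> = (if l = i then det M else 0)"
    proof (cases "l = i")
      case True
      then have "?N = M"
        by (auto simp: vec_eq_iff row_def)
      then show ?thesis using True by simp
    next
      case False
      then show ?thesis
        using det_identical_rows[of l i ?N] by (auto simp: row_def vec_eq_iff)
    qed
    finally show ?thesis by (simp add: mat_def)
  qed
  then show ?thesis by (simp add: vec_eq_iff)
qed

lemma adjugate_transpose_mul:
  fixes M :: "'a::comm_ring_1^'n^'n::finite"
  shows "transpose (adjugate (transpose M)) ** M = mat (det M)"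
proof -
  have "transpose (adjugate (transpose M)) ** M = transpose (transpose M ** adjugate (transpose M))"
    by (simp add: matrix_transpose_mul)
  also have "\<dots> = mat (det M)"
    by (simp add: matrix_mul_adjugate det_transpose)
  finally show ?thesis .
qed

lemma mat_mult: "mat a ** N = (\<chi> i j. a * (N $ i $ j))"
  for N :: "'a::comm_ring_1^'m::finite^'n::finite"
  by (auto simp: vec_eq_iff matrix_matrix_mult_def mat_def if_distrib if_distribR sum.delta' cong: if_cong)

lemma mat_mult_commute: "N ** mat a = mat a ** N"
  for N :: "'a::comm_ring_1^'n^'n::finite"
  by (auto simp: vec_eq_iff matrix_matrix_mult_def mat_def if_distrib if_distribR sum.delta sum.delta'
      mult.commute cong: if_cong)

text \<open>
  With \<open>L M = M R = d\<close>, the matrix \<open>B = d R\<close> satisfies \<open>B M = L (M R) M = d L M = d\<^sup>2\<close>. So the square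
  of the determinant avoids proving that the left and right adjugates agree.
\<close>

lemma exists_quasi_inverse:
  fixes M :: "'a::comm_ring_1^'n^'n::finite"
  obtains B where "M ** B = mat ((det M)\<^sup>2)" "B ** M = mat ((det M)\<^sup>2)"
proof
  let ?d = "mat (det M) :: 'a^'n^'n"
  let ?L = "transpose (adjugate (transpose M))" and ?R = "adjugate M"
  have dd: "?d ** ?d = mat ((det M)\<^sup>2)"
    by (simp add: mat_mult) (simp add: mat_def vec_eq_iff power2_eq_square)
  show "M ** (?d ** ?R) = mat ((det M)\<^sup>2)"
    by (metis dd mat_mult_commute matrix_mul_adjugate matrix_mul_assoc)
  have "?d ** ?R ** M = ?L ** (M ** ?R) ** M"
    by (simp add: adjugate_transpose_mul matrix_mul_assoc)
  also have "\<dots> = ?d ** ?d"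
    by (metis adjugate_transpose_mul mat_mult_commute matrix_mul_adjugate matrix_mul_assoc)
  finally show "?d ** ?R ** M = mat ((det M)\<^sup>2)"
    by (simp add: dd)
qed

section \<open>Derivations\<close>

text \<open>No linearity over \<open>'k\<close> is built in; vanishing on \<open>Const a\<close> is
  a separate hypothesis wherever it matters.\<close>

definition derivation :: "('a::comm_ring_1 \<Rightarrow> 'a) \<Rightarrow> bool" where
  "derivation d \<longleftrightarrow> (\<forall>f g. d (f + g) = d f + d g) \<and> (\<forall>f g. d (f * g) = f * d g + d f * g)"

context
  fixes d :: "'a::comm_ring_1 \<Rightarrow> 'a"
  assumes d: "derivation d"
begin

lemma derivation_add: "d (f + g) = d f + d g"
  using d by (simp add: derivation_def)

lemma derivation_mult: "d (f * g) = f * d g + d f * g"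
  using d by (simp add: derivation_def)

lemma derivation_0: "d 0 = 0"
  using derivation_add[of 0 0] by simp

lemma derivation_1: "d 1 = 0"
  using derivation_mult[of 1 1] by simp

lemma derivation_diff: "d (f - g) = d f - d g"
  using derivation_add[of "f - g" g] by (simp add: algebra_simps)

lemma derivation_sum: "d (sum h S) = (\<Sum>x\<in>S. d (h x))"
  by (induction S rule: infinite_finite_induct) (simp_all add: derivation_0 derivation_add)

lemma derivation_of_nat: "d (of_nat m) = 0"
  by (induction m) (simp_all add: derivation_0 derivation_1 derivation_add)

lemma derivation_power: "d (f ^ m) = of_nat m * f ^ (m - 1) * d f"
proof (induction m)
  case (Suc m)
  then show ?case
    by (cases m) (simp_all add: derivation_mult algebra_simps)
qed (simp add: derivation_1)

lemma derivation_power_CHAR: "of_nat p = (0 :: 'a) \<Longrightarrow> d (f ^ p) = 0"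
  by (simp add: derivation_power)

lemma derivation_scale: "derivation (\<lambda>f. c * d f)"
  by (simp add: derivation_def derivation_add derivation_mult algebra_simps)

lemma derivation_mult_const: "d c = 0 \<Longrightarrow> d (c * f) = c * d f"
  by (simp add: derivation_mult)

lemma derivation_mult_consts: "d c = 0 \<Longrightarrow> d f = 0 \<Longrightarrow> d (c * f) = 0"
  by (simp add: derivation_mult)

lemma derivation_power_const: "d c = 0 \<Longrightarrow> d (c ^ m) = 0"
  by (simp add: derivation_power)

lemma funpow_derivation_0: "(d ^^ n) 0 = 0"
  by (induction n) (simp_all add: derivation_0)

lemma funpow_derivation_add: "(d ^^ n) (f + g) = (d ^^ n) f + (d ^^ n) g"
  by (induction n) (simp_all add: derivation_add)

lemma funpow_derivation_diff: "(d ^^ n) (f - g) = (d ^^ n) f - (d ^^ n) g"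
  by (induction n) (simp_all add: derivation_diff)

lemma funpow_derivation_mult_const: "d c = 0 \<Longrightarrow> (d ^^ n) (c * f) = c * (d ^^ n) f"
  by (induction n) (simp_all add: derivation_mult_const)

lemma funpow_derivation_mult:
  "(d ^^ n) (f * g) = (\<Sum>k\<le>n. of_nat (n choose k) * (d ^^ k) f * (d ^^ (n - k)) g)"
proof (induction n)
  case (Suc n)
  let ?t = "\<lambda>k l. (d ^^ k) f * (d ^^ l) g"
  have "(d ^^ Suc n) (f * g) = (\<Sum>k\<le>n. of_nat (n choose k) * (?t (Suc k) (n - k) + ?t k (Suc (n - k))))"
    by (simp add: Suc derivation_sum derivation_mult derivation_of_nat algebra_simps)
  also have "\<dots> = (\<Sum>k\<le>n. of_nat (n choose k) * ?t (Suc k) (n - k)) +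
      (\<Sum>k\<le>n. of_nat (n choose k) * ?t k (Suc n - k))"
    by (simp add: sum.distrib distrib_left Suc_diff_le)
  \<comment> \<open>The added top term vanishes since \<open>n choose Suc n\<close> is 0; after the
    index shift, Pascal's rule applies termwise.\<close>
  also have "(\<Sum>k\<le>n. of_nat (n choose k) * ?t k (Suc n - k)) =
      (\<Sum>k\<le>Suc n. of_nat (n choose k) * ?t k (Suc n - k))"
    by (simp add: binomial_eq_0)
  also have "\<dots> = ?t 0 (Suc n) + (\<Sum>k\<le>n. of_nat (n choose Suc k) * ?t (Suc k) (n - k))"
    by (subst sum.atMost_Suc_shift) simp
  also have "(\<Sum>k\<le>n. of_nat (n choose k) * ?t (Suc k) (n - k)) +
      (?t 0 (Suc n) + (\<Sum>k\<le>n. of_nat (n choose Suc k) * ?t (Suc k) (n - k))) =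
      ?t 0 (Suc n) + (\<Sum>k\<le>n. of_nat (Suc n choose Suc k) * ?t (Suc k) (n - k))"
    by (simp add: sum.distrib[symmetric] algebra_simps)
  also have "\<dots> = (\<Sum>k\<le>Suc n. of_nat (Suc n choose k) * ?t k (Suc n - k))"
    by (subst sum.atMost_Suc_shift) simp
  finally show ?case by (simp add: mult.assoc)
qed simp

text \<open>In the Leibniz rule for \<open>d ^^ p\<close> the binomial coefficients with
  \<open>0 < k < p\<close> are divisible by \<open>p\<close>, so only the two end terms
  survive.\<close>

lemma derivation_funpow_CHAR:
  assumes p: "prime p" and p0: "of_nat p = (0 :: 'a)"
  shows "derivation (d ^^ p)"
proof -
  have "(d ^^ p) (f * g) = f * (d ^^ p) g + (d ^^ p) f * g" for f g
  proof -
    have "(d ^^ p) (f * g) = (\<Sum>k\<in>{0,p}. of_nat (p choose k) * (d ^^ k) f * (d ^^ (p - k)) g)"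
      unfolding funpow_derivation_mult
    proof (intro sum.mono_neutral_right ballI)
      fix k assume "k \<in> {..p} - {0, p}"
      then have "p dvd (p choose k)"
        by (intro dvd_choose_prime p) auto
      then have "of_nat (p choose k) = (0 :: 'a)"
        using p0 by (auto elim!: dvdE)
      then show "of_nat (p choose k) * (d ^^ k) f * (d ^^ (p - k)) g = 0"
        by simp
    qed auto
    then show ?thesis
      using prime_gt_0_nat[OF p] by simp
  qed
  then show ?thesis
    by (simp add: derivation_def funpow_derivation_add)
qed

text \<open>On powers of \<open>f\<close> the map \<open>d\<close> acts as \<open>c\<close> times
  differentiation in \<open>f\<close>, and \<open>c\<close> passes through \<open>d\<close> as a
  constant.\<close>

lemma funpow_derivation_power:
  assumes "d f = c" "d c = 0"
  shows "(d ^^ m) (f ^ m) = of_nat (fact m) * c ^ m"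
proof (induction m)
  case (Suc m)
  have "(d ^^ Suc m) (f ^ Suc m) = (d ^^ m) (d (f ^ Suc m))"
    by (simp add: funpow_Suc_right del: funpow.simps)
  also have "d (f ^ Suc m) = of_nat (Suc m) * c * f ^ m"
    by (simp only: derivation_power assms diff_Suc_1) (simp add: algebra_simps)
  also have "(d ^^ m) (of_nat (Suc m) * c * f ^ m) = of_nat (Suc m) * c * (d ^^ m) (f ^ m)"
    by (intro funpow_derivation_mult_const derivation_mult_consts derivation_of_nat assms)
  also have "\<dots> = of_nat (fact (Suc m)) * c ^ Suc m"
    by (simp add: Suc algebra_simps)
  finally show ?case .
qed simp

end

lemma derivation_commutator:
  assumes "derivation d" "derivation e"
  shows "derivation (\<lambda>f. d (e f) - e (d f))"
  unfolding derivation_def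
  by (simp add: derivation_add[OF assms(1)] derivation_add[OF assms(2)]
      derivation_mult[OF assms(1)] derivation_mult[OF assms(2)] algebra_simps)

lemma derivation_linear_combination:
  assumes "\<And>k. k \<in> S \<Longrightarrow> derivation (d k)"
  shows "derivation (\<lambda>f. \<Sum>k\<in>S. b k * d k f)"
  using assms
  by (simp add: derivation_def sum.distrib[symmetric] sum_distrib_left sum_distrib_right algebra_simps)

lemma derivation_minus:
  assumes "derivation d" "derivation e"
  shows "derivation (\<lambda>f. d f - e f)"
  using assms by (simp add: derivation_def algebra_simps)

section \<open>Polynomials\<close>

lemma mpoly_eq_sum_single:
  fixes f :: "'a \<Rightarrow>\<^sub>0 'b::comm_monoid_add"
  shows "f = (\<Sum>m\<in>Poly_Mapping.keys f. Poly_Mapping.single m (Poly_Mapping.lookup f m))"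
  by (rule poly_mapping_eqI)
    (simp add: lookup_sum lookup_single when_def sum.delta' in_keys_iff)

lemma mpoly_induct [case_names single add]:
  fixes f :: "'a \<Rightarrow>\<^sub>0 'b::comm_monoid_add"
  assumes single: "\<And>m a. P (Poly_Mapping.single m a)"
    and add: "\<And>f g. P f \<Longrightarrow> P g \<Longrightarrow> P (f + g)"
  shows "P f"
proof -
  have "P (\<Sum>m\<in>S. Poly_Mapping.single m (Poly_Mapping.lookup f m))" for S
    by (induction S rule: infinite_finite_induct) (use single[of undefined 0] in \<open>auto intro: single add\<close>)
  then show ?thesis
    by (subst mpoly_eq_sum_single)
qed

lemma Const_mult: "Const (a * b) = Const a * Const b"
  for a b :: "'k::comm_ring_1"
  by (simp add: Const_def mult_single)

lemma Const_1: "Const 1 = (1 :: ('n, 'k::comm_ring_1) mpoly)"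
  by (simp add: Const_def)

lemma Const_of_nat: "Const (of_nat m) = (of_nat m :: ('n, 'k::comm_ring_1) mpoly)"
  by (simp add: Const_def)

lemma CHAR_mpoly: "CHAR(('n, 'k::comm_ring_1) mpoly) = CHAR('k)"
proof (rule CHAR_eqI)
  show "of_nat CHAR('k) = (0 :: ('n, 'k) mpoly)"
    by (simp flip: Const_of_nat) (simp add: Const_def)
next
  fix x assume "of_nat x = (0 :: ('n, 'k) mpoly)"
  then have "Poly_Mapping.lookup (Const (of_nat x) :: ('n, 'k) mpoly) 0 = 0"
    by (simp add: Const_of_nat)
  then show "CHAR('k) dvd x"
    by (simp only: Const_def lookup_single_eq of_nat_eq_0_iff_char_dvd)
qed

lemma Var_power:
  "Var i ^ m = (Poly_Mapping.single (Poly_Mapping.single i m) 1 :: ('n, 'k::comm_ring_1) mpoly)"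
  by (induction m) (simp_all add: Var_def mult_single flip: single_add)

lemma exponent_eq_sum: "m = (\<Sum>i\<in>UNIV. Poly_Mapping.single i (Poly_Mapping.lookup m i))"
  for m :: "'n::finite \<Rightarrow>\<^sub>0 nat"
  by (rule poly_mapping_eqI) (simp add: lookup_sum lookup_single when_def sum.delta')

lemma prod_single:
  "finite S \<Longrightarrow> (\<Prod>i\<in>S. Poly_Mapping.single (h i) 1) =
    (Poly_Mapping.single (sum h S) 1 :: ('n, 'k::comm_ring_1) mpoly)"
  by (induction S rule: finite_induct) (simp_all add: mult_single)

lemma single_eq_prod_Var:
  fixes a :: "'k::comm_ring_1" and m :: "'n::finite \<Rightarrow>\<^sub>0 nat"
  shows "Poly_Mapping.single m a = Const a * (\<Prod>i\<in>UNIV. Var i ^ Poly_Mapping.lookup m i)"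
  by (simp add: Var_power prod_single Const_def mult_single flip: exponent_eq_sum)

section \<open>Subalgebras of the polynomial ring\<close>

context
  fixes A :: "('n, 'k::comm_ring_1) mpoly set"
  assumes A: "is_subalgebra A"
begin

lemma subalgebra_Const: "Const a \<in> A"
  using A by (simp add: is_subalgebra_def)

lemma subalgebra_add: "f \<in> A \<Longrightarrow> g \<in> A \<Longrightarrow> f + g \<in> A"
  using A by (simp add: is_subalgebra_def)

lemma subalgebra_mult: "f \<in> A \<Longrightarrow> g \<in> A \<Longrightarrow> f * g \<in> A"
  using A by (simp add: is_subalgebra_def)

lemma subalgebra_1: "1 \<in> A"
  using subalgebra_Const[of 1] by (simp add: Const_1)

lemma subalgebra_0: "0 \<in> A"
  using subalgebra_Const[of 0] by (simp add: Const_def)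

lemma subalgebra_power: "f \<in> A \<Longrightarrow> f ^ m \<in> A"
  by (induction m) (auto intro: subalgebra_mult subalgebra_1)

lemma subalgebra_sum: "(\<And>x. x \<in> S \<Longrightarrow> h x \<in> A) \<Longrightarrow> sum h S \<in> A"
  by (induction S rule: infinite_finite_induct) (auto intro: subalgebra_add subalgebra_0)

lemma subalgebra_prod: "(\<And>x. x \<in> S \<Longrightarrow> h x \<in> A) \<Longrightarrow> prod h S \<in> A"
  by (induction S rule: infinite_finite_induct) (auto intro: subalgebra_mult subalgebra_1)

end

lemma subalgebra_Var_eq_UNIV:
  fixes A :: "('n::finite, 'k::comm_ring_1) mpoly set"
  assumes "is_subalgebra A" "\<And>i. Var i \<in> A"
  shows "A = UNIV"
proof -
  have "f \<in> A" for f
    by (induction f rule: mpoly_induct)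
      (auto simp: single_eq_prod_Var
        intro!: assms subalgebra_mult subalgebra_Const subalgebra_prod subalgebra_power subalgebra_add)
  then show ?thesis by auto
qed

text \<open>The kernel of \<open>d\<close> is a subalgebra containing the variables, hence
  everything.\<close>

lemma derivation_eq_0:
  fixes d :: "('n::finite, 'k::comm_ring_1) mpoly \<Rightarrow> ('n, 'k) mpoly"
  assumes d: "derivation d" and C: "\<And>a. d (Const a) = 0" and V: "\<And>i. d (Var i) = 0"
  shows "d f = 0"
proof -
  have "{f. d f = 0} = UNIV"
    by (rule subalgebra_Var_eq_UNIV)
      (auto simp: is_subalgebra_def C V derivation_add[OF d] derivation_mult[OF d])
  then show ?thesis by auto
qed

section \<open>Formal partial derivatives\<close>

lemma partial_deriv_add: "partial_deriv i (f + g) = partial_deriv i f + partial_deriv i g"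
  by (rule poly_mapping_eqI) (simp add: lookup_partial_deriv lookup_add algebra_simps)

lemma partial_deriv_single:
  "partial_deriv i (Poly_Mapping.single m a) =
    Poly_Mapping.single (m - Poly_Mapping.single i 1) (of_nat (Poly_Mapping.lookup m i) * a)"
  by (cases "a = 0") (simp_all add: partial_deriv_def)

text \<open>The hypothesis excludes truncation on the right; in the Leibniz rule for monomials the
  excluded case carries coefficient 0.\<close>

lemma exponent_add_diff:
  fixes m n :: "'n \<Rightarrow>\<^sub>0 nat"
  assumes "Poly_Mapping.lookup n i \<noteq> 0"
  shows "m + n - Poly_Mapping.single i 1 = m + (n - Poly_Mapping.single i 1)"
  by (rule poly_mapping_eqI)
    (use assms in \<open>auto simp: lookup_add lookup_minus lookup_single when_def\<close>)

lemma partial_deriv_mult_single: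
  fixes a b :: "'k::comm_ring_1" and m n :: "'n \<Rightarrow>\<^sub>0 nat"
  defines "f \<equiv> Poly_Mapping.single m a" and "g \<equiv> Poly_Mapping.single n b"
  shows "partial_deriv i (f * g) = f * partial_deriv i g + partial_deriv i f * g"
proof -
  let ?e = "Poly_Mapping.single i (1::nat)"
  let ?l = "Poly_Mapping.lookup"
  have 1: "Poly_Mapping.single (m + (n - ?e)) (of_nat (?l n i) * (a * b)) =
      Poly_Mapping.single (m + n - ?e) (of_nat (?l n i) * (a * b))"
    by (cases "?l n i = 0") (simp_all add: exponent_add_diff[of n i, unfolded One_nat_def])
  have 2: "Poly_Mapping.single ((m - ?e) + n) (of_nat (?l m i) * (a * b)) =
      Poly_Mapping.single (m + n - ?e) (of_nat (?l m i) * (a * b))"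
    by (cases "?l m i = 0")
      (simp_all add: exponent_add_diff[of m i, unfolded One_nat_def] add.commute[of _ n])
  have "partial_deriv i (f * g) =
      Poly_Mapping.single (m + n - ?e) (of_nat (?l n i) * (a * b) + of_nat (?l m i) * (a * b))"
    by (simp add: f_def g_def mult_single partial_deriv_single lookup_add algebra_simps)
  also have "\<dots> = f * partial_deriv i g + partial_deriv i f * g"
    unfolding single_add 1[symmetric] 2[symmetric]
    by (simp add: f_def g_def mult_single partial_deriv_single mult.left_commute mult.assoc)
  finally show ?thesis .
qed

lemma derivation_partial_deriv:
  "derivation (partial_deriv i :: ('a, 'b::comm_ring_1) mpoly \<Rightarrow> ('a, 'b) mpoly)"
proof -
  have "partial_deriv i (f * g) = f * partial_deriv i g + partial_deriv i f * g"
    for f g :: "('a, 'b) mpoly"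
  proof (induction f rule: mpoly_induct)
    case (single m a)
    show ?case
      by (induction g rule: mpoly_induct)
        (simp_all add: partial_deriv_mult_single partial_deriv_add distrib_left)
  qed (simp add: partial_deriv_add algebra_simps)
  then show ?thesis
    by (simp add: derivation_def partial_deriv_add)
qed

lemma partial_deriv_Const: "partial_deriv i (Const a) = 0"
  by (simp add: Const_def partial_deriv_single)

lemma partial_deriv_Var: "partial_deriv i (Var k) = (if i = k then 1 else 0)"
  by (auto simp: Var_def partial_deriv_single lookup_single)

text \<open>Both sides are derivations agreeing on constants and variables, so
  \<open>derivation_eq_0\<close> applies to their difference.\<close>

lemma derivation_chain_rule:
  fixes d :: "('n::finite, 'k::comm_ring_1) mpoly \<Rightarrow> ('n, 'k) mpoly"
  assumes d: "derivation d" and C: "\<And>a. d (Const a) = 0"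
  shows "d f = (\<Sum>k\<in>UNIV. d (Var k) * partial_deriv k f)"
proof -
  let ?e = "\<lambda>f. d f - (\<Sum>k\<in>UNIV. d (Var k) * partial_deriv k f)"
  have "?e f = 0"
    by (rule derivation_eq_0[of ?e])
      (auto intro!: derivation_minus d derivation_linear_combination derivation_partial_deriv
        simp: C partial_deriv_Const partial_deriv_Var if_distrib sum.delta cong: if_cong)
  then show ?thesis by simp
qed

text \<open>Comparing coefficients, the characteristic divides every exponent of a monomial that
  occurs in \<open>f\<close>; such a monomial is a constant times powers of the
  \<open>Var i ^ CHAR('k)\<close>.\<close>

lemma partial_deriv_kernel_subset:
  fixes A :: "('n::finite, 'k::field) mpoly set"
  assumes A: "is_subalgebra A" "\<And>i. Var i ^ CHAR('k) \<in> A"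
    and f: "\<And>i. partial_deriv i f = 0"
  shows "f \<in> A"
proof -
  have "Poly_Mapping.single m (Poly_Mapping.lookup f m) \<in> A"
    if m: "m \<in> Poly_Mapping.keys f" for m
  proof -
    have "CHAR('k) dvd Poly_Mapping.lookup m i" for i
    proof (cases "Poly_Mapping.lookup m i = 0")
      case False
      let ?e = "Poly_Mapping.single i (1::nat)"
      \<comment> \<open>The coefficient of \<open>f\<close> at \<open>m\<close> reappears in the
        partial derivative at \<open>m - ?e\<close>; nothing is truncated, as the exponent is
        positive here.\<close>
      have eq: "m - ?e + ?e = m"
        by (rule poly_mapping_eqI)
          (use False in \<open>auto simp: lookup_add lookup_minus lookup_single when_def\<close>)
      have "Suc (Poly_Mapping.lookup (m - ?e) i) = Poly_Mapping.lookup m i"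
        using False by (simp add: lookup_minus)
      then have "of_nat (Poly_Mapping.lookup m i) * Poly_Mapping.lookup f m = 0"
        using lookup_partial_deriv[of i f "m - ?e"] by (simp only: eq f lookup_zero)
      with m show ?thesis
        by (simp add: in_keys_iff of_nat_eq_0_iff_char_dvd)
    qed simp
    then have "Var i ^ Poly_Mapping.lookup m i \<in> A" for i
      using subalgebra_power[OF A(1) A(2)[of i]] by (metis dvdE power_mult)
    then show ?thesis
      unfolding single_eq_prod_Var
      by (intro subalgebra_mult[OF A(1)] subalgebra_Const[OF A(1)] subalgebra_prod[OF A(1)])
  qed
  then show ?thesis
    by (subst mpoly_eq_sum_single) (rule subalgebra_sum[OF A(1)])
qed

section \<open>Descent along derivations dual to a tuple\<close>

lemma of_nat_fact_invertible:
  assumes "prime CHAR('k)" "m < CHAR('k)"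
  shows "Const (inverse (of_nat (fact m))) * of_nat (fact m) = (1 :: ('n, 'k::field) mpoly)"
proof -
  have "of_nat (fact m) \<noteq> (0 :: 'k)"
    using assms by (simp add: of_nat_eq_0_iff_char_dvd prime_dvd_fact_iff del: of_nat_fact)
  then show ?thesis
    by (simp only: Const_of_nat[symmetric] Const_mult[symmetric]) (simp add: Const_1)
qed

text \<open>Two nested inductions: the outer one over a finite set of indices outside of which every
  \<open>E k\<close> kills \<open>g\<close>, with \<open>ker\<close> as its base; the inner one on
  the order to which a single \<open>E i\<close> is nilpotent at \<open>g\<close>.\<close>

lemma derivation_descent:
  fixes A :: "('n, 'k::field) mpoly set" and E :: "'i::finite \<Rightarrow> ('n, 'k) mpoly \<Rightarrow> ('n, 'k) mpoly"
  assumes A: "is_subalgebra A" and p: "prime CHAR('k)"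
    and E: "\<And>i. derivation (E i)"
    and fA: "\<And>i. f i \<in> A" and cA: "c \<in> A"
    and Ef: "\<And>i k. E i (f k) = (if i = k then c else 0)" and Ec: "\<And>i. E i c = 0"
    and comm: "\<And>i k g. E i (E k g) = E k (E i g)"
    and nil: "\<And>i g. (E i ^^ CHAR('k)) g = 0"
    and ker: "\<And>g. (\<And>i. E i g = 0) \<Longrightarrow> \<exists>N. c ^ N * g \<in> A"
  shows "\<exists>N. c ^ N * g \<in> A"
proof -
  have comm_pow: "E k ((E i ^^ m) g) = (E i ^^ m) (E k g)" for i k m g
    by (induction m) (simp_all add: comm[of k i])
  have "\<exists>N. c ^ N * g \<in> A" if "finite S" "\<And>k. k \<notin> S \<Longrightarrow> E k g = 0" for S g
    using that
  proof (induction S arbitrary: g rule: finite_induct)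
    case empty
    then show ?case by (intro ker) simp
  next
    case (insert i S)
    \<comment> \<open>The bound on \<open>m\<close> keeps the factorials invertible;
      \<open>nil\<close> supplies the case \<open>m = CHAR('k)\<close>.\<close>
    have "\<exists>N. c ^ N * g \<in> A"
      if "m \<le> CHAR('k)" "\<And>k. k \<notin> insert i S \<Longrightarrow> E k g = 0" "(E i ^^ m) g = 0" for m g
      using that
    proof (induction m arbitrary: g)
      case 0
      then show ?case using subalgebra_0[OF A] by simp
    next
      case (Suc m)
      define h where "h = (E i ^^ m) g"
      \<comment> \<open>Subtracting the leading Taylor term of \<open>g\<close> in \<open>f i\<close> lowers the nilpotency order.\<close>
      define g' where "g' = of_nat (fact m) * c ^ m * g - f i ^ m * h"
      \<comment> \<open>Also \<open>E i\<close> kills \<open>h\<close>, as \<open>E i h\<close> is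
        \<open>(E i ^^ Suc m) g\<close>; so the outer induction hypothesis for \<open>S\<close>
        covers \<open>h\<close>.\<close>
      have Eh: "E k h = 0" if "k \<notin> S" for k
        using Suc.prems(2)[of k] Suc.prems(3) that
        by (cases "k = i") (simp_all add: h_def comm_pow funpow_derivation_0[OF E] funpow_swap1)
      then obtain N1 where N1: "c ^ N1 * h \<in> A"
        using insert.IH[of h] by blast
      have const: "E k (of_nat (fact m) * c ^ m) = 0" for k
        by (simp add: derivation_mult_consts[OF E] derivation_of_nat[OF E]
            derivation_power_const[OF E] Ec del: of_nat_fact)
      have "E k g' = 0" if k: "k \<notin> insert i S" for k
      proof -
        have "E k (f i ^ m) = 0"
          using k by (intro derivation_power_const[OF E]) (simp add: Ef)
        then have "E k (f i ^ m * h) = 0"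
          using Eh k by (intro derivation_mult_consts[OF E]) auto
        then show ?thesis
          by (simp only: g'_def derivation_diff[OF E] derivation_mult_const[OF E const]
              Suc.prems(2)[OF k] mult_zero_right diff_self)
      qed
      moreover have "(E i ^^ m) g' = 0"
      proof -
        have "(E i ^^ m) (f i ^ m * h) = h * (E i ^^ m) (f i ^ m)"
          unfolding mult.commute[of _ h]
          by (intro funpow_derivation_mult_const[OF E] Eh insert.hyps(2))
        also have "(E i ^^ m) (f i ^ m) = of_nat (fact m) * c ^ m"
          by (rule funpow_derivation_power[OF E]) (simp_all add: Ef Ec)
        finally show ?thesis
          by (simp only: g'_def funpow_derivation_diff[OF E] funpow_derivation_mult_const[OF E const])
            (simp add: h_def mult.commute)
      qed
      ultimately obtain N2 where N2: "c ^ N2 * g' \<in> A"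
        using Suc.IH[of g'] Suc.prems(1) by fastforce
      define u :: "('n, 'k) mpoly" where "u = Const (inverse (of_nat (fact m)))"
      have u: "u * of_nat (fact m) = 1"
        unfolding u_def by (rule of_nat_fact_invertible) (use p Suc.prems(1) in auto)
      \<comment> \<open>The terms with \<open>f i ^ m * h\<close> cancel, leaving a power of
        \<open>c\<close> times \<open>of_nat (fact m) * g\<close>; \<open>u\<close> removes the
        factorial.\<close>
      have "u * (c ^ N1 * (c ^ N2 * g') + c ^ N2 * (f i ^ m * (c ^ N1 * h))) \<in> A"
        unfolding u_def
        by (intro subalgebra_mult[OF A] subalgebra_add[OF A] subalgebra_Const[OF A]
            subalgebra_power[OF A] N1 N2 cA fA)
      also have "u * (c ^ N1 * (c ^ N2 * g') + c ^ N2 * (f i ^ m * (c ^ N1 * h))) =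
          (u * of_nat (fact m)) * c ^ (N1 + N2 + m) * g"
        by (simp add: g'_def power_add algebra_simps)
      finally show ?case
        unfolding u by auto
    qed
    from this[OF order_refl insert.prems nil] show ?case by simp
  qed
  from this[of UNIV] show ?thesis by simp
qed

text \<open>Cramer's rule for the Jacobian matrix supplies the derivations for
  \<open>derivation_descent\<close>. Their relations need checking only on constants and on
  \<open>F\<close>, at the cost of a factor \<open>c0\<close>.\<close>

lemma jacobian_det_power_mult_mem:
  fixes A :: "('n::finite, 'k::field) mpoly set" and F :: "('n, 'k) mpoly ^ 'n"
  assumes A: "is_subalgebra A" and p: "prime CHAR('k)"
    and V: "\<And>i. Var i ^ CHAR('k) \<in> A" and F: "\<And>i. F $ i \<in> A"
  shows "\<exists>N. jacobian_det F ^ (CHAR('k) * N) * g \<in> A"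
proof -
  define p where "p = CHAR('k)"
  have p1: "prime p" "p > 1"
    using p prime_gt_1_nat[OF p] by (auto simp: p_def)
  have p0: "of_nat p = (0 :: ('n, 'k) mpoly)"
    using of_nat_CHAR[where 'a = "('n, 'k) mpoly"] by (simp add: CHAR_mpoly p_def)
  define M where "M = (\<chi> i j. partial_deriv j (F $ i))"
  define q where "q = (jacobian_det F)\<^sup>2"
  obtain B where "M ** B = mat q" "B ** M = mat q"
    using exists_quasi_inverse[of M] by (auto simp: q_def jacobian_det_def M_def)
  then have MB: "(\<Sum>k\<in>UNIV. M $ i $ k * B $ k $ j) = (if i = j then q else 0)"
    and BM: "(\<Sum>k\<in>UNIV. B $ i $ k * M $ k $ j) = (if i = j then q else 0)" for i j
    by (simp_all add: vec_eq_iff matrix_matrix_mult_def mat_def)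
  define c0 where "c0 = q ^ p"
  have c0: "c0 = q ^ (p - 1) * q"
    using p1 by (simp add: c0_def flip: power_Suc2)
  have c0_const: "d c0 = 0" if "derivation d" for d
    using derivation_power_CHAR[OF that p0] by (simp add: c0_def)

  \<comment> \<open>By the chain rule, \<open>M\<close> sends the vector of the
    \<open>d (Var l)\<close> to that of the \<open>d (F $ i)\<close>, which is 0; applying
    \<open>B\<close> gives \<open>q * d (Var k) = 0\<close>.\<close>
  have kill: "c0 * d g = 0"
    if d: "derivation d" and C: "\<And>a. d (Const a) = 0" and dF: "\<And>i. d (F $ i) = 0" for d g
  proof -
    have "q * d (Var k) = 0" for k
    proof -
      have "q * d (Var k) = (\<Sum>l\<in>UNIV. (if k = l then q else 0) * d (Var l))"
        by (simp add: if_distrib if_distribR sum.delta' cong: if_cong)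
      also have "\<dots> = (\<Sum>i\<in>UNIV. B $ k $ i * (\<Sum>l\<in>UNIV. M $ i $ l * d (Var l)))"
        unfolding BM[symmetric] sum_distrib_left sum_distrib_right mult.assoc
        by (rule sum.swap)
      also have "\<dots> = (\<Sum>i\<in>UNIV. B $ k $ i * d (F $ i))"
        by (simp add: derivation_chain_rule[OF d C, of "F $ _"] M_def mult.commute)
      finally show ?thesis by (simp add: dF)
    qed
    then have "c0 * d (Var k) = 0" for k
      by (simp add: c0 mult.assoc)
    then have "(\<Sum>k\<in>UNIV. (c0 * d (Var k)) * partial_deriv k g) = 0"
      by simp
    then show ?thesis
      by (subst derivation_chain_rule[OF d C]) (simp add: sum_distrib_left mult.assoc)
  qed

  \<comment> \<open>The factor \<open>q ^ (p - 1)\<close> turns the value \<open>q\<close> from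
    Cramer's rule into the \<open>p\<close>-th power \<open>c0\<close>, a constant for every
    derivation.\<close>
  define D where "D i f = (\<Sum>k\<in>UNIV. (q ^ (p - 1) * B $ k $ i) * partial_deriv k f)" for i f
  have D: "derivation (D i)" for i
    unfolding D_def by (intro derivation_linear_combination derivation_partial_deriv)
  have DC: "D i (Const a) = 0" for i a
    by (simp add: D_def partial_deriv_Const)
  have DF: "D i (F $ l) = (if i = l then c0 else 0)" for i l
  proof -
    have "D i (F $ l) = q ^ (p - 1) * (\<Sum>k\<in>UNIV. M $ l $ k * B $ k $ i)"
      by (simp add: D_def M_def sum_distrib_left mult_ac)
    then show ?thesis
      by (simp add: MB c0)
  qed
  have D_c0: "D i c0 = 0" for i
    by (rule c0_const[OF D])
  \<comment> \<open>Summing the \<open>D i f\<close> against column \<open>k\<close> of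
    \<open>M\<close> recovers \<open>partial_deriv k f\<close> up to the factor
    \<open>c0\<close>.\<close>
  have D_kernel: "c0 * (c0 * partial_deriv k f) = 0" if "\<And>i. D i f = 0" for k f
  proof -
    have "c0 * partial_deriv k f =
        (\<Sum>l\<in>UNIV. q ^ (p - 1) * (if l = k then q else 0) * partial_deriv l f)"
      by (simp add: c0 if_distrib if_distribR sum.delta cong: if_cong)
    also have "\<dots> = (\<Sum>i\<in>UNIV. M $ i $ k * D i f)"
      unfolding BM[symmetric] D_def sum_distrib_left sum_distrib_right
      by (subst sum.swap) (simp add: mult_ac)
    finally show ?thesis by (simp add: that)
  qed
  have D_comm: "c0 * D i (D k f) = c0 * D k (D i f)" for i k f
  proof -
    have "c0 * (D i (D k f) - D k (D i f)) = 0"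
      by (rule kill) (auto intro: derivation_commutator D simp: DC DF D_c0 derivation_0[OF D])
    then show ?thesis by (simp add: algebra_simps)
  qed
  have D_nil: "c0 * (D i ^^ p) f = 0" for i f
  proof (rule kill[OF derivation_funpow_CHAR[OF D p1(1) p0]])
    \<comment> \<open>Two applications are split off: on \<open>F $ l\<close> the first may give
      \<open>c0\<close>, and the second then gives 0.\<close>
    obtain r where r: "p = Suc (Suc r)"
      using p1(2) by (intro that[of "p - 2"]) simp
    show "(D i ^^ p) (Const a) = 0" "(D i ^^ p) (F $ l) = 0" for a l
      by (simp_all add: r funpow_Suc_right DC DF D_c0 derivation_0[OF D]
          funpow_derivation_0[OF D] del: funpow.simps)
  qed

  \<comment> \<open>The polynomial ring is not known here to be a domain, so the extra factor absorbs the \<open>c0\<close>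
    in \<open>D_comm\<close> and \<open>D_nil\<close>.\<close>
  define E where "E i f = c0 * D i f" for i f
  have E: "derivation (E i)" for i
    unfolding E_def by (rule derivation_scale[OF D])
  have E_pow: "(E i ^^ m) f = c0 ^ m * (D i ^^ m) f" for i m f
    by (induction m) (simp_all add: E_def derivation_mult_const[OF D derivation_power_const[OF D D_c0]]
        algebra_simps)
  define c where "c = c0 * c0"
  have c_eq: "c = (q\<^sup>2) ^ p"
    by (simp add: c_def c0_def power2_eq_square power_mult_distrib)
  \<comment> \<open>A \<open>p\<close>-th power lies in \<open>A\<close> for arbitrary
    \<open>f\<close>, because its partial derivatives vanish.\<close>
  have kernel: "f ^ p \<in> A" "(\<And>k. partial_deriv k f = 0) \<Longrightarrow> f \<in> A" for f
    using partial_deriv_kernel_subset[OF A V] derivation_power_CHAR[OF derivation_partial_deriv p0]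
    by auto
  have "\<exists>N. c ^ N * g \<in> A"
  proof (rule derivation_descent[where E = E and f = "\<lambda>i. F $ i", OF A p E F])
    show "c \<in> A"
      unfolding c_eq by (rule kernel(1))
    show "E i (F $ k) = (if i = k then c else 0)" for i k
      by (simp add: E_def DF c_def)
    show "E i c = 0" for i
      unfolding c_def by (intro derivation_mult_consts[OF E] c0_const[OF E])
    show "E i (E k f) = E k (E i f)" for i k f
      using D_comm[of i k f] by (simp add: E_def derivation_mult_const[OF D D_c0])
    show "(E i ^^ CHAR('k)) f = 0" for i f
    proof -
      have "(E i ^^ p) f = c0 ^ (p - 1) * (c0 * (D i ^^ p) f)"
        using p1 by (simp add: E_pow flip: power_Suc2 mult.assoc)
      then show ?thesis
        by (simp add: D_nil flip: p_def)
    qed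
    show "\<exists>N. c ^ N * f \<in> A" if f: "\<And>i. E i f = 0" for f
    proof -
      have "D i (c0 * f) = 0" for i
        using f[of i] by (simp add: E_def derivation_mult_const[OF D D_c0])
      \<comment> \<open>At \<open>c0 * f\<close>, \<open>D_kernel\<close> shows that
        \<open>c0 ^ 3\<close> annihilates \<open>partial_deriv k f\<close>, while
        \<open>c ^ 2\<close> is \<open>c0 ^ 4\<close>.\<close>
      from D_kernel[OF this] have "partial_deriv k (c ^ 2 * f) = 0" for k
        by (simp add: c_def derivation_mult_const derivation_partial_deriv c0_const
            power2_eq_square mult.assoc)
      then show ?thesis
        using kernel(2) by blast
    qed
  qed
  then obtain N where "c ^ N * g \<in> A" ..
  also have "c ^ N = jacobian_det F ^ (p * (4 * N))"
    by (simp add: c_eq q_def mult_ac flip: power_mult)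
  finally show ?thesis
    unfolding p_def by blast
qed

section \<open>From single Jacobians to the unit Jacobian ideal\<close>

theorem mainTheorem2:
  fixes R :: "('n::finite, 'k::field) mpoly set" and p :: nat
  assumes "CHAR('k) = p" and "p > 0"
    and "is_subalgebra R"
    and "jacobian_ideal R = UNIV"
  shows "adjoin R (range (\<lambda>i. Var i ^ p)) = UNIV"
proof -
  define A where "A = adjoin R (range (\<lambda>i. Var i ^ p))"
  have A: "is_subalgebra A"
    unfolding A_def by (rule is_subalgebra_adjoin)
  have sub: "R \<union> range (\<lambda>i. Var i ^ p) \<subseteq> A"
    unfolding A_def adjoin_def by (rule hull_subset)
  then have V: "Var i ^ CHAR('k) \<in> A" for i
    using assms(1) by auto
  have p: "prime CHAR('k)"
    using assms(1,2) by (intro prime_CHAR_semidom) simp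
  have p0: "of_nat p = (0 :: ('n, 'k) mpoly)"
    using of_nat_CHAR[where 'a = "('n, 'k) mpoly"] assms(1) by (simp add: CHAR_mpoly)
  have pow: "f ^ (p * m) \<in> A" for f m
    using partial_deriv_kernel_subset[OF A V, of "f ^ p"]
      derivation_power_CHAR[OF derivation_partial_deriv p0] subalgebra_power[OF A]
    by (simp add: power_mult)
  have "1 \<in> jacobian_ideal R"
    by (simp add: assms(4))
  then obtain T r where T: "finite T" "T \<subseteq> {jacobian_det F | F. \<forall>i. F $ i \<in> R}"
    and one: "1 = (\<Sum>t\<in>T. r t * t)"
    unfolding jacobian_ideal_def module.span_explicit[OF module_self] by auto
  have "g \<in> A" for g
  proof -
    have "\<exists>N. t ^ (p * N) * g \<in> A" if t: "t \<in> T" for t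
    proof -
      from t T(2) obtain F where F: "t = jacobian_det F" "\<And>i. F $ i \<in> R"
        by blast
      show ?thesis
        using jacobian_det_power_mult_mem[OF A p V, of F] F sub assms(1) by auto
    qed
    then obtain N where N: "t ^ (p * N t) * g \<in> A" if "t \<in> T" for t
      by metis
    \<comment> \<open>A common exponent for all \<open>t\<close>:
      \<open>N t \<le> e \<le> p ^ e\<close>, and a power of \<open>p\<close> is wanted for
      Frobenius. Raising the exponent only multiplies by a \<open>p\<close>-th power, which is in
      \<open>A\<close>.\<close>
    define e where "e = (\<Sum>t\<in>T. N t)"
    have N': "t ^ (p * p ^ e) * g \<in> A" if t: "t \<in> T" for t
    proof -
      have "N t \<le> e"
        unfolding e_def by (rule member_le_sum) (use t T(1) in auto)
      also have "e \<le> p ^ e"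
        using prime_gt_1_nat[OF p] assms(1) by (intro less_imp_le power_gt_expt) auto
      finally have "t ^ (p * p ^ e) * g = t ^ (p * (p ^ e - N t)) * (t ^ (p * N t) * g)"
        by (simp flip: power_add mult.assoc distrib_left)
      then show ?thesis
        using subalgebra_mult[OF A pow N[OF t]] by simp
    qed
    \<comment> \<open>As \<open>p * p ^ e\<close> is \<open>p ^ Suc e\<close>, the power distributes
      over the sum and turns the arbitrary coefficients \<open>r t\<close> into elements of
      \<open>A\<close>.\<close>
    have "1 = (\<Sum>t\<in>T. r t * t) ^ (p * p ^ e)"
      by (simp flip: one)
    also have "\<dots> = (\<Sum>t\<in>T. (r t * t) ^ (p * p ^ e))"
      by (rule freshmans_dream_sum'[where n = "Suc e"]) (use p assms(1) in \<open>simp_all add: CHAR_mpoly\<close>)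
    finally have "g = (\<Sum>t\<in>T. (r t * t) ^ (p * p ^ e)) * g"
      by simp
    also have "\<dots> = (\<Sum>t\<in>T. r t ^ (p * p ^ e) * (t ^ (p * p ^ e) * g))"
      by (simp add: sum_distrib_right power_mult_distrib mult.assoc)
    also have "\<dots> \<in> A"
      by (intro subalgebra_sum[OF A] subalgebra_mult[OF A] pow N')
    finally show ?thesis .
  qed
  then show ?thesis
    by (auto simp: A_def)
qed

end
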